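(* Let $m$ be a positive integer, $\Lambda_1,\dots,\Lambda_{m-1}\ge0$ and $\Lambda_0>1$. Let $F(z)=\sum_{k=0}^{m-1}\bar z^k f_k(z)$ be a poly-analytic function on $\mathbb{D}$, where all $f_k$ are holomorphic on $\mathbb{D}$, satisfying $f_k(0)=0$ for $k\in\{0,1,\dots,m-1\}$ and $F_z(0)=1$. Suppose that $|f_0'(z)|<\Lambda_0$ and $|f_k'(z)|\le\Lambda_k$ for $k\in\{1,\dots,m-1\}$, for all $z\in\mathbb{D}$. Let $r_3$ be the unique root in $(0,1)$ of the equation $$\Lambda_0\frac{1-\Lambda_0 r}{\Lambda_0-r}-\sum_{k=1}^{m-1}(k+1)\Lambda_k r^k=0.$$ Then for each $\rho_3\in(0,r_3)$, the function $F$ is bi-Lipschitz on $\overline{\mathbb{D}}_{\rho_3}$; namely, with $$l_3=\frac{\Lambda_0(1-\Lambda_0\rho_3)}{\Lambda_0-\rho_3}-\sum_{k=1}^{m-1}(k+1)\Lambda_k\rho_3^k,\qquad L_3=\Lambda_0+\sum_{k=1}^{m-1}\rho_3^k(k+1)\Lambda_k,$$ one has $l_3>0$ and $$l_3|z_1-z_2|\le|F(z_1)-F(z_2)|\le L_3|z_1-z_2|\quad\text{for all } z_1,z_2\in\overline{\mathbb{D}}_{\rho_3}.$$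
   Context: $\mathbb{D}=\{z\in\mathbb{C}:|z|<1\}$, $\mathbb{D}_r=\{z\in\mathbb{C}:|z|<r\}$, and $\overline{\mathbb{D}}_r$ is its closure. A complex-valued $C^m$ function $F$ on a domain is poly-analytic of order $m\ge1$ if $\partial^m F/\partial\bar z^m=0$; equivalently $F(z)=\sum_{k=0}^{m-1}\bar z^k f_k(z)$ with $f_k$ analytic. $F_z=\partial F/\partial z$ is the Wirtinger derivative. A map $g$ on $\Omega\subset\mathbb{C}$ is bi-Lipschitz if there are constants $l,L>0$ with $l|z_1-z_2|\le|g(z_1)-g(z_2)|\le L|z_1-z_2|$ for all $z_1,z_2\in\Omega$. Empty sums are $0$. *)

theory Defs
  imports "HOL-Complex_Analysis.Complex_Analysis"
begin

(* F_z = (F_x - i F_y) / 2, the partial derivatives being the values of the real Frechet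
   derivative at 1 and at \<i>.  Meaningful only where F is real-differentiable. *)
definition wirtinger_dz :: "(complex \<Rightarrow> complex) \<Rightarrow> complex \<Rightarrow> complex" where
  "wirtinger_dz F z =
     (frechet_derivative F (at z) 1 - \<i> * frechet_derivative F (at z) \<i>) / 2"

definition bi_lipschitz_with ::
    "real \<Rightarrow> real \<Rightarrow> complex set \<Rightarrow> (complex \<Rightarrow> complex) \<Rightarrow> bool" where
  "bi_lipschitz_with l L \<Omega> g \<longleftrightarrow> l > 0 \<and> L > 0 \<and>
     (\<forall>z1\<in>\<Omega>. \<forall>z2\<in>\<Omega>. l * cmod (z1 - z2) \<le> cmod (g z1 - g z2)
                     \<and> cmod (g z1 - g z2) \<le> L * cmod (z1 - z2))"

definition bi_lipschitz_on :: "complex set \<Rightarrow> (complex \<Rightarrow> complex) \<Rightarrow> bool" where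
  "bi_lipschitz_on \<Omega> g \<longleftrightarrow> (\<exists>l L. bi_lipschitz_with l L \<Omega> g)"

definition lower_const :: "nat \<Rightarrow> (nat \<Rightarrow> real) \<Rightarrow> real \<Rightarrow> real" where
  "lower_const m \<Lambda> r =
     \<Lambda> 0 * (1 - \<Lambda> 0 * r) / (\<Lambda> 0 - r) - (\<Sum>k = 1..<m. real (k + 1) * \<Lambda> k * r ^ k)"

definition upper_const :: "nat \<Rightarrow> (nat \<Rightarrow> real) \<Rightarrow> real \<Rightarrow> real" where
  "upper_const m \<Lambda> r = \<Lambda> 0 + (\<Sum>k = 1..<m. r ^ k * real (k + 1) * \<Lambda> k)"

end

theory Submission
  imports Defs
begin

(* The Schwarz-Pick lemma, applied to f_0'/\<Lambda>_0, bounds Re f_0' below on the disc of radius \<rho>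
   by \<Lambda>_0 (1 - \<Lambda>_0 \<rho>) / (\<Lambda>_0 - \<rho>).  The mean value theorem along the segment from z_2 to z_1 turns
   this into a lower bound for |f_0(z_1) - f_0(z_2)|.  Each remaining summand cnj z^k f_k(z) is Lipschitz
   with constant (k + 1) \<Lambda>_k \<rho>^k and is treated as a perturbation of f_0. *)

section \<open>Schwarz-Pick estimate for the real part\<close>

text \<open>Following \<open>g\<close> with the disc automorphism that moves \<open>a\<close> to 0
  gives a self-map of the disc fixing 0. The Schwarz lemma then confines \<open>g z\<close> to the
  pseudo-hyperbolic disc of radius \<rho> about \<open>a\<close>. This is a Euclidean disc centred
  on the real axis, and the bound is its leftmost point.\<close>

lemma Schwarz_Pick_Re_ge:
  fixes g :: "complex \<Rightarrow> complex" and a \<rho> :: real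
  assumes hol: "g holomorphic_on ball 0 1"
    and lt1: "\<And>z. z \<in> ball 0 1 \<Longrightarrow> cmod (g z) < 1"
    and g0: "g 0 = of_real a" and "0 \<le> a"
    and z: "cmod z \<le> \<rho>" "\<rho> < 1"
  shows "(a - \<rho>) / (1 - a * \<rho>) \<le> Re (g z)"
proof -
  have a1: "a < 1"
    using lt1[of 0] g0 \<open>0 \<le> a\<close> by simp
  have \<rho>0: "0 \<le> \<rho>"
    using z norm_ge_zero order_trans by blast
  \<comment> \<open>The difference factors as (1 - a^2)(1 - |w|^2). Hence w -> (w - a)/(1 - a w)
    maps the unit disc into itself, with no zero of the denominator there.\<close>
  have pos: "(cmod (1 - of_real a * w))\<^sup>2 - (cmod (w - of_real a))\<^sup>2 > 0" if "cmod w < 1" for w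
  proof -
    have "(cmod (1 - of_real a * w))\<^sup>2 - (cmod (w - of_real a))\<^sup>2 = (1 - a\<^sup>2) * (1 - (cmod w)\<^sup>2)"
      unfolding cmod_power2 by (simp add: algebra_simps power2_eq_square)
    moreover have "a\<^sup>2 < 1" "(cmod w)\<^sup>2 < 1"
      using a1 \<open>0 \<le> a\<close> that by (simp_all add: power_less_one_iff)
    ultimately show ?thesis by simp
  qed
  define \<omega> where "\<omega> w = (g w - of_real a) / (1 - of_real a * g w)" for w
  have lt: "cmod (g w - of_real a) < cmod (1 - of_real a * g w)" if "w \<in> ball 0 1" for w
    using pos[OF lt1[OF that]] by (smt (verit) norm_ge_zero power_mono)
  have nz: "1 - of_real a * g w \<noteq> 0" if "w \<in> ball 0 1" for w
    using lt[OF that] by force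
  have "cmod (\<omega> z) \<le> cmod z"
  proof (rule Schwarz_Lemma)
    show "\<omega> holomorphic_on ball 0 1"
      unfolding \<omega>_def using nz by (intro holomorphic_intros hol) auto
    show "\<omega> 0 = 0" by (simp add: \<omega>_def g0)
    show "cmod (\<omega> w) < 1" if "cmod w < 1" for w
    proof -
      have "w \<in> ball 0 1" using that by simp
      then show ?thesis
        using lt nz by (auto simp: \<omega>_def norm_divide)
    qed
    show "cmod z < 1" using z by simp
  qed
  then have "cmod (g z - of_real a) \<le> cmod z * cmod (1 - of_real a * g z)"
    using nz[of z] z by (simp add: \<omega>_def norm_divide divide_simps)
  also have "\<dots> \<le> \<rho> * cmod (1 - of_real a * g z)"
    using z by (simp add: mult_right_mono)
  finally have "(cmod (g z - of_real a))\<^sup>2 \<le> (\<rho> * cmod (1 - of_real a * g z))\<^sup>2"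
    by (simp add: power_mono)
  then have sq: "(cmod (g z - of_real a))\<^sup>2 \<le> \<rho>\<^sup>2 * (cmod (1 - of_real a * g z))\<^sup>2"
    by (simp add: power_mult_distrib)
  define x y where "x = Re (g z)" and "y = Im (g z)"
  have a\<rho>: "a * \<rho> < 1"
    using a1 \<open>0 \<le> a\<close> z \<rho>0 by (smt (verit) mult_left_le)
  \<comment> \<open>In coordinates the disc condition is a quadratic in \<open>x\<close> plus a
    nonnegative multiple of y^2. The linear factors vanish where the boundary circle meets the real
    axis, so dropping the y^2 term leaves \<open>x\<close> between these two roots.\<close>
  have "((1 - a * \<rho>) * x - (a - \<rho>)) * ((1 + a * \<rho>) * x - (a + \<rho>)) + (1 - (a * \<rho>)\<^sup>2) * y\<^sup>2
      = (cmod (g z - of_real a))\<^sup>2 - \<rho>\<^sup>2 * (cmod (1 - of_real a * g z))\<^sup>2"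
    unfolding cmod_power2 x_def y_def by (simp add: power2_eq_square algebra_simps)
  moreover have "(a * \<rho>)\<^sup>2 < 1"
    using a\<rho> \<open>0 \<le> a\<close> \<rho>0 by (simp add: power_less_one_iff)
  then have "0 \<le> (1 - (a * \<rho>)\<^sup>2) * y\<^sup>2" by simp
  ultimately have prod: "((1 - a * \<rho>) * x - (a - \<rho>)) * ((1 + a * \<rho>) * x - (a + \<rho>)) \<le> 0"
    using sq by linarith
  have "a - \<rho> \<le> (1 - a * \<rho>) * x"
  \<comment> \<open>To the left of the smaller root both factors would be negative and their product
    positive. That the roots are in this order reduces to a^2 \<rho> \<le> \<rho>.\<close>
  proof (rule ccontr)
    assume "\<not> ?thesis"
    then have n1: "(1 - a * \<rho>) * x - (a - \<rho>) < 0" by simp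
    then have "x < (a - \<rho>) / (1 - a * \<rho>)"
      using a\<rho> by (simp add: field_simps)
    also have "\<dots> \<le> (a + \<rho>) / (1 + a * \<rho>)"
    proof -
      have "a * a * \<rho> \<le> 1 * \<rho>"
        using a1 \<open>0 \<le> a\<close> \<rho>0 by (intro mult_right_mono) (auto intro: mult_le_one)
      then have "(a - \<rho>) * (1 + a * \<rho>) \<le> (a + \<rho>) * (1 - a * \<rho>)"
        by (simp add: algebra_simps)
      moreover have "0 < 1 + a * \<rho>"
        using \<open>0 \<le> a\<close> \<rho>0 by (simp add: add_pos_nonneg)
      ultimately show ?thesis
        using a\<rho> by (simp add: frac_le_eq divide_le_0_iff)
    qed
    finally have "(1 + a * \<rho>) * x - (a + \<rho>) < 0"
      using \<open>0 \<le> a\<close> \<rho>0 by (simp add: pos_less_divide_eq add_pos_nonneg mult.commute)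
    with n1 prod show False
      by (smt (verit) mult_neg_neg)
  qed
  then show ?thesis
    using a\<rho> by (simp add: x_def pos_divide_le_eq mult.commute)
qed

section \<open>Increment estimates\<close>

text \<open>The mean value theorem is available for real parts only. Applied to \<open>f\<close>
  divided by the increment \<open>d\<close>, it yields a point \<open>u\<close> of the segment at
  which the real part of the difference quotient equals Re (f' u), and a modulus dominates the real
  part.\<close>

lemma norm_diff_ge_of_Re_deriv_ge:
  fixes f f' :: "complex \<Rightarrow> complex"
  assumes "convex S"
    and der: "\<And>z. z \<in> S \<Longrightarrow> (f has_field_derivative f' z) (at z)"
    and Re_ge: "\<And>z. z \<in> S \<Longrightarrow> c \<le> Re (f' z)"
    and "w \<in> S" "z \<in> S"
  shows "c * cmod (z - w) \<le> cmod (f z - f w)"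
proof (cases "z = w")
  case False
  have seg: "closed_segment w z \<subseteq> S"
    using assms by (simp add: closed_segment_subset)
  define d where "d = z - w"
  have d: "d \<noteq> 0" using False by (simp add: d_def)
  have "\<exists>u. u \<in> closed_segment w z \<and> Re (f z / d) - Re (f w / d) = Re (f' u / d * (z - w))"
    by (rule complex_mvt_line[where f = "\<lambda>x. f x / d"])
      (use seg der in \<open>auto intro!: DERIV_cdivide\<close>)
  then obtain u where u: "u \<in> S" "Re (f z / d) - Re (f w / d) = Re (f' u / d * (z - w))"
    using seg by blast
  then have "c \<le> Re ((f z - f w) / d)"
    using Re_ge[OF u(1)] d by (simp add: d_def diff_divide_distrib)
  also have "\<dots> \<le> cmod (f z - f w) / cmod d"
    using complex_Re_le_cmod[of "(f z - f w) / d"] by (simp add: norm_divide)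
  finally show ?thesis
    using d by (simp add: d_def pos_le_divide_eq)
qed simp

lemma norm_power_diff_le:
  fixes z w :: complex
  assumes "cmod z \<le> \<rho>" "cmod w \<le> \<rho>"
  shows "cmod (z ^ k - w ^ k) \<le> real k * \<rho> ^ (k - 1) * cmod (z - w)"
proof (rule field_differentiable_bound[where S = "cball 0 \<rho>" and f' = "\<lambda>x. of_nat k * x ^ (k - 1)"])
  \<comment> \<open>At k = 0 the truncated exponent \<open>k - 1\<close> is 0, but the factor
    \<open>k\<close> makes both the derivative and the bound vanish.\<close>
  show "((\<lambda>x. x ^ k) has_field_derivative of_nat k * x ^ (k - 1)) (at x within cball 0 \<rho>)" for x :: complex
    by (auto intro!: derivative_eq_intros)
  show "cmod (of_nat k * x ^ (k - 1)) \<le> real k * \<rho> ^ (k - 1)" if "x \<in> cball 0 \<rho>" for x :: complex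
    using that by (simp add: norm_mult norm_power mult_left_mono power_mono)
qed (use assms in simp_all)

lemma norm_diff_le_of_deriv_le:
  fixes f :: "complex \<Rightarrow> complex"
  assumes hol: "f holomorphic_on ball 0 1"
    and le: "\<And>z. z \<in> ball 0 1 \<Longrightarrow> cmod (deriv f z) \<le> B"
    and "z \<in> ball 0 1" "w \<in> ball 0 1"
  shows "cmod (f z - f w) \<le> B * cmod (z - w)"
proof (rule field_differentiable_bound[where S = "ball 0 1" and f' = "deriv f"])
  show "(f has_field_derivative deriv f u) (at u within ball 0 1)" if "u \<in> ball 0 1" for u
    using that by (intro holomorphic_derivI[OF hol]) auto
qed (rule convex_ball, fact+)

text \<open>Split the increment of the product in two. The increment of \<open>f\<close> contributes
  B \<rho>^k. The increment of the conjugate power contributes k \<rho>^(k-1) times |f w|, which is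
  at most B \<rho> because \<open>f\<close> vanishes at 0. Together they give the factor k +
  1.\<close>

lemma norm_cnj_power_mult_diff_le:
  fixes f :: "complex \<Rightarrow> complex"
  assumes hol: "f holomorphic_on ball 0 1" and f0: "f 0 = 0"
    and le: "\<And>z. z \<in> ball 0 1 \<Longrightarrow> cmod (deriv f z) \<le> B"
    and z: "cmod z \<le> \<rho>" and w: "cmod w \<le> \<rho>" and "\<rho> < 1" and "1 \<le> k"
  shows "cmod (cnj z ^ k * f z - cnj w ^ k * f w) \<le> real (k + 1) * B * \<rho> ^ k * cmod (z - w)"
proof -
  have zw: "z \<in> ball 0 1" "w \<in> ball 0 1" using z w \<open>\<rho> < 1\<close> by auto
  have \<rho>0: "0 \<le> \<rho>"
    using z norm_ge_zero order_trans by blast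
  have B: "0 \<le> B" by (rule order_trans[OF norm_ge_zero le[of 0]]) simp
  have "cmod (f w) \<le> B * cmod w"
    using norm_diff_le_of_deriv_le[OF hol le, of w 0] zw f0 by simp
  also have "\<dots> \<le> B * \<rho>" using w B by (simp add: mult_left_mono)
  finally have fw: "cmod (f w) \<le> B * \<rho>" .
  have "cnj z ^ k * f z - cnj w ^ k * f w = cnj z ^ k * (f z - f w) + (cnj z ^ k - cnj w ^ k) * f w"
    by (simp add: algebra_simps)
  then have "cmod (cnj z ^ k * f z - cnj w ^ k * f w)
      \<le> cmod (cnj z ^ k) * cmod (f z - f w) + cmod (cnj z ^ k - cnj w ^ k) * cmod (f w)"
    by (metis norm_mult norm_triangle_ineq)
  \<comment> \<open>The power estimate is applied to the conjugate points; conjugation preserves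
    moduli and distances.\<close>
  also have "\<dots> \<le> \<rho> ^ k * (B * cmod (z - w)) + (real k * \<rho> ^ (k - 1) * cmod (cnj z - cnj w)) * (B * \<rho>)"
    using z w \<rho>0 fw norm_diff_le_of_deriv_le[OF hol le zw] norm_power_diff_le[of "cnj z" \<rho> "cnj w" k]
    by (intro add_mono mult_mono) (auto simp: norm_power power_mono)
  also have "cmod (cnj z - cnj w) = cmod (z - w)"
    by (metis complex_cnj_diff complex_mod_cnj)
  also have "\<rho> ^ k * (B * cmod (z - w)) + (real k * \<rho> ^ (k - 1) * cmod (z - w)) * (B * \<rho>)
      = B * \<rho> ^ k * cmod (z - w) + real k * B * (\<rho> ^ (k - 1) * \<rho>) * cmod (z - w)"
    by (simp add: algebra_simps)
  also have "\<rho> ^ (k - 1) * \<rho> = \<rho> ^ k"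
    by (rule power_minus_mult) (use \<open>1 \<le> k\<close> in simp)
  finally show ?thesis by (simp add: algebra_simps)
qed

section \<open>Normalisation at the origin\<close>

text \<open>For k \<ge> 1 both the conjugate power and \<open>f k\<close> vanish at 0, so the
  product has zero derivative there and only \<open>f 0\<close> contributes. This turns the
  condition on F_z(0) into one on the derivative of \<open>f 0\<close>.\<close>

lemma wirtinger_dz_polyanalytic_0:
  fixes f :: "nat \<Rightarrow> complex \<Rightarrow> complex"
  assumes m: "1 \<le> m" and hol: "\<And>k. k < m \<Longrightarrow> f k holomorphic_on ball 0 1"
    and F: "\<And>z. z \<in> ball 0 1 \<Longrightarrow> F z = (\<Sum>k<m. cnj z ^ k * f k z)"
    and f0: "\<And>k. k < m \<Longrightarrow> f k 0 = 0"
  shows "wirtinger_dz F 0 = deriv (f 0) 0"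
proof -
  have "((\<lambda>z. cnj z ^ k * f k z) has_derivative (\<lambda>h. if k = 0 then deriv (f 0) 0 * h else 0)) (at 0)"
    if "k < m" for k
  proof -
    have d: "(f k has_derivative (\<lambda>h. deriv (f k) 0 * h)) (at 0)"
      using holomorphic_derivI[OF hol[OF that], of 0] by (simp add: has_field_derivative_def)
    have c: "(cnj has_derivative cnj) (at 0)"
      by (simp add: bounded_linear_cnj bounded_linear_imp_has_derivative)
    show ?thesis
      by (rule has_derivative_eq_rhs[OF has_derivative_mult[OF has_derivative_power[OF c] d]])
        (auto simp: f0[OF that])
  qed
  then have "((\<lambda>z. \<Sum>k<m. cnj z ^ k * f k z) has_derivative
      (\<lambda>h. \<Sum>k<m. if k = 0 then deriv (f 0) 0 * h else 0)) (at 0)"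
    by (intro has_derivative_sum) auto
  then have "((\<lambda>z. \<Sum>k<m. cnj z ^ k * f k z) has_derivative (\<lambda>h. deriv (f 0) 0 * h)) (at 0)"
    using m by simp
  then have "(F has_derivative (\<lambda>h. deriv (f 0) 0 * h)) (at 0)"
    by (rule has_derivative_transform_within_open[where s = "ball 0 1"]) (auto simp: F)
  then have "frechet_derivative F (at 0) = (\<lambda>h. deriv (f 0) 0 * h)"
    by (rule frechet_derivative_at[symmetric])
  \<comment> \<open>For a complex-linear derivative h -> a h, the Wirtinger formula gives (a - \<i>
    (a \<i>)) / 2 = a.\<close>
  then show ?thesis
    by (simp add: wirtinger_dz_def algebra_simps)
qed

section \<open>The root of \<open>lower_const\<close>\<close>

context
  fixes m :: nat and \<Lambda> :: "nat \<Rightarrow> real"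
  assumes \<Lambda>0: "\<Lambda> 0 > 1" and \<Lambda>k: "\<And>k. 1 \<le> k \<Longrightarrow> k < m \<Longrightarrow> \<Lambda> k \<ge> 0"
begin

text \<open>Strictness comes from the fractional term: cross-multiplication leaves (\<Lambda>_0^2 -
  1)(s - r) > 0. The subtracted sum is nondecreasing since its coefficients are nonnegative.\<close>

lemma lower_const_strict_antimono:
  assumes "0 \<le> r" "r < s" "s \<le> 1"
  shows "lower_const m \<Lambda> s < lower_const m \<Lambda> r"
proof -
  have "(1 - \<Lambda> 0 * r) * (\<Lambda> 0 - s) - (1 - \<Lambda> 0 * s) * (\<Lambda> 0 - r) = ((\<Lambda> 0)\<^sup>2 - 1) * (s - r)"
    by (simp add: algebra_simps power2_eq_square)
  also have "\<dots> > 0" using \<Lambda>0 assms by (simp add: one_less_power)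
  finally have "(1 - \<Lambda> 0 * s) / (\<Lambda> 0 - s) < (1 - \<Lambda> 0 * r) / (\<Lambda> 0 - r)"
    using \<Lambda>0 assms by (simp add: frac_less_eq divide_less_0_iff)
  then have "\<Lambda> 0 * (1 - \<Lambda> 0 * s) / (\<Lambda> 0 - s) < \<Lambda> 0 * (1 - \<Lambda> 0 * r) / (\<Lambda> 0 - r)"
    unfolding times_divide_eq_right[symmetric] using \<Lambda>0 by (intro mult_strict_left_mono) auto
  moreover have "(\<Sum>k = 1..<m. real (k + 1) * \<Lambda> k * r ^ k) \<le> (\<Sum>k = 1..<m. real (k + 1) * \<Lambda> k * s ^ k)"
    using assms \<Lambda>k by (intro sum_mono mult_left_mono power_mono) auto
  ultimately show ?thesis unfolding lower_const_def by linarith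
qed

text \<open>The function is 1 at 0 and at most -\<Lambda>_0 at 1, so the intermediate value theorem
  gives a root and strict monotonicity makes it unique.\<close>

lemma ex1_root_lower_const: "\<exists>!r. r \<in> {0<..<1} \<and> lower_const m \<Lambda> r = 0"
proof -
  have "(\<Sum>k = 1..<m. real (k + 1) * \<Lambda> k * 0 ^ k) = 0"
    by (intro sum.neutral) auto
  then have at0: "lower_const m \<Lambda> 0 = 1"
    using \<Lambda>0 by (simp add: lower_const_def)
  have "\<Lambda> 0 * (1 - \<Lambda> 0) / (\<Lambda> 0 - 1) = - \<Lambda> 0"
    using \<Lambda>0 by (simp add: divide_simps) (simp add: algebra_simps)
  moreover have "0 \<le> (\<Sum>k = 1..<m. real (k + 1) * \<Lambda> k * 1 ^ k)"
    using \<Lambda>k by (intro sum_nonneg) auto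
  ultimately have at1: "lower_const m \<Lambda> 1 < 0"
    using \<Lambda>0 unfolding lower_const_def by simp
  have "continuous_on {0..1} (lower_const m \<Lambda>)"
    unfolding lower_const_def[abs_def] using \<Lambda>0 by (intro continuous_intros) auto
  then obtain r where r: "0 \<le> r" "r \<le> 1" "lower_const m \<Lambda> r = 0"
    using IVT2'[of "lower_const m \<Lambda>" 1 0 0] at0 at1 by auto
  then have "r \<noteq> 0" "r \<noteq> 1" using at0 at1 by auto
  with r have "r \<in> {0<..<1} \<and> lower_const m \<Lambda> r = 0" by auto
  moreover have "r' = r" if "r' \<in> {0<..<1} \<and> lower_const m \<Lambda> r' = 0" for r'
    using that r lower_const_strict_antimono[of r r'] lower_const_strict_antimono[of r' r]
    by (cases r r' rule: linorder_cases) auto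
  ultimately show ?thesis by blast
qed

end

section \<open>The two-sided estimate\<close>

text \<open>The radius \<rho> is fixed here, and the root is represented by the condition
  \<open>pos\<close> alone.\<close>

lemma bi_lipschitz_with_polyanalytic:
  fixes m :: nat and \<Lambda> :: "nat \<Rightarrow> real"
    and f :: "nat \<Rightarrow> complex \<Rightarrow> complex" and F :: "complex \<Rightarrow> complex"
  assumes m: "m \<ge> 1" and \<Lambda>0: "\<Lambda> 0 > 1"
    and \<Lambda>k: "\<And>k. 1 \<le> k \<Longrightarrow> k < m \<Longrightarrow> \<Lambda> k \<ge> 0"
    and hol: "\<And>k. k < m \<Longrightarrow> f k holomorphic_on ball 0 1"
    and F: "\<And>z. z \<in> ball 0 1 \<Longrightarrow> F z = (\<Sum>k<m. cnj z ^ k * f k z)"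
    and f0: "\<And>k. k < m \<Longrightarrow> f k 0 = 0"
    and F0: "wirtinger_dz F 0 = 1"
    and d0: "\<And>z. z \<in> ball 0 1 \<Longrightarrow> cmod (deriv (f 0) z) < \<Lambda> 0"
    and dk: "\<And>k z. 1 \<le> k \<Longrightarrow> k < m \<Longrightarrow> z \<in> ball 0 1 \<Longrightarrow> cmod (deriv (f k) z) \<le> \<Lambda> k"
    and \<rho>: "0 \<le> \<rho>" "\<rho> < 1" and pos: "lower_const m \<Lambda> \<rho> > 0"
  shows "bi_lipschitz_with (lower_const m \<Lambda> \<rho>) (upper_const m \<Lambda> \<rho>) (cball 0 \<rho>) F"
proof -
  define S where "S = (\<Sum>k = 1..<m. real (k + 1) * \<Lambda> k * \<rho> ^ k)"
  define c where "c = \<Lambda> 0 * (1 - \<Lambda> 0 * \<rho>) / (\<Lambda> 0 - \<rho>)"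
  have lower: "lower_const m \<Lambda> \<rho> = c - S" unfolding lower_const_def c_def S_def ..
  have upper: "upper_const m \<Lambda> \<rho> = \<Lambda> 0 + S" unfolding upper_const_def S_def by (simp add: mult.commute mult.left_commute)
  have S0: "0 \<le> S" unfolding S_def using \<Lambda>k \<rho> by (intro sum_nonneg) auto
  have hol0: "f 0 holomorphic_on ball 0 1" using hol m by simp
  have "deriv (f 0) 0 = 1"
    using wirtinger_dz_polyanalytic_0[of m f F] m hol F f0 F0 by simp
  \<comment> \<open>Division by \<Lambda>_0 turns the strict bound \<open>d0\<close> into a map into
    the open unit disc, with value 1/\<Lambda>_0 at 0; this is the \<open>a\<close> of the
    Schwarz-Pick estimate.\<close>
  then have g0: "deriv (f 0) 0 / of_real (\<Lambda> 0) = of_real (1 / \<Lambda> 0)" by simp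
  have Re_ge: "c \<le> Re (deriv (f 0) z)" if "z \<in> cball 0 \<rho>" for z
  proof -
    have "(1 / \<Lambda> 0 - \<rho>) / (1 - 1 / \<Lambda> 0 * \<rho>) \<le> Re (deriv (f 0) z / of_real (\<Lambda> 0))"
    proof (rule Schwarz_Pick_Re_ge[where g = "\<lambda>z. deriv (f 0) z / of_real (\<Lambda> 0)"])
      show "(\<lambda>z. deriv (f 0) z / of_real (\<Lambda> 0)) holomorphic_on ball 0 1"
        using \<Lambda>0 by (intro holomorphic_intros hol0) auto
    qed (use g0 d0 \<Lambda>0 that \<rho> in \<open>auto simp: norm_divide\<close>)
    moreover have "(1 / \<Lambda> 0 - \<rho>) / (1 - 1 / \<Lambda> 0 * \<rho>) = (1 - \<Lambda> 0 * \<rho>) / (\<Lambda> 0 - \<rho>)"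
      using \<Lambda>0 \<rho> by (simp add: field_simps)
    ultimately have "(1 - \<Lambda> 0 * \<rho>) / (\<Lambda> 0 - \<rho>) \<le> Re (deriv (f 0) z) / \<Lambda> 0"
      by simp
    then show ?thesis
      using \<Lambda>0 by (simp add: c_def pos_le_divide_eq mult.commute)
  qed
  have bounds: "(c - S) * cmod (z - w) \<le> cmod (F z - F w) \<and> cmod (F z - F w) \<le> (\<Lambda> 0 + S) * cmod (z - w)"
    if zw: "z \<in> cball 0 \<rho>" "w \<in> cball 0 \<rho>" for z w
  proof -
    have ball: "z \<in> ball 0 1" "w \<in> ball 0 1" using zw \<rho> by auto
    define E where "E = (\<Sum>k = 1..<m. cnj z ^ k * f k z - cnj w ^ k * f k w)"
    \<comment> \<open>Splitting off k = 0 isolates \<open>f 0\<close>, which \<open>c\<close> bounds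
      from below and \<Lambda>_0 from above; the rest \<open>E\<close> shifts either bound by at
      most \<open>S\<close> times the distance.\<close>
    have "{..<m} = insert 0 {1..<m}" using m by auto
    then have FE: "F z - F w = (f 0 z - f 0 w) + E"
      using F ball by (simp add: E_def sum_subtractf)
    have "cmod E \<le> (\<Sum>k = 1..<m. real (k + 1) * \<Lambda> k * \<rho> ^ k * cmod (z - w))"
      unfolding E_def using zw \<rho> hol f0 dk
      by (intro sum_norm_le norm_cnj_power_mult_diff_le) auto
    then have E: "cmod E \<le> S * cmod (z - w)"
      by (simp add: S_def sum_distrib_right)
    have up: "cmod (f 0 z - f 0 w) \<le> \<Lambda> 0 * cmod (z - w)"
      using norm_diff_le_of_deriv_le[OF hol0 _ ball] d0 less_imp_le by blast
    have lo: "c * cmod (z - w) \<le> cmod (f 0 z - f 0 w)"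
    proof (rule norm_diff_ge_of_Re_deriv_ge[where S = "cball 0 \<rho>" and f' = "deriv (f 0)"])
      show "(f 0 has_field_derivative deriv (f 0) u) (at u)" if "u \<in> cball 0 \<rho>" for u
        using that \<rho> by (intro holomorphic_derivI[OF hol0]) auto
    qed (use Re_ge zw in auto)
    have "cmod (f 0 z - f 0 w) - cmod E \<le> cmod (F z - F w)"
      unfolding FE by (rule norm_diff_ineq)
    moreover have "cmod (F z - F w) \<le> cmod (f 0 z - f 0 w) + cmod E"
      unfolding FE by (rule norm_triangle_ineq)
    ultimately show ?thesis
      using E up lo by (simp add: algebra_simps)
  qed
  show ?thesis
    unfolding bi_lipschitz_with_def lower upper
    using bounds pos S0 \<Lambda>0 by (simp add: lower)
qed

theorem theorem4p3:
  fixes m :: nat and \<Lambda> :: "nat \<Rightarrow> real"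
    and f :: "nat \<Rightarrow> complex \<Rightarrow> complex" and F :: "complex \<Rightarrow> complex"
  assumes "m \<ge> 1"
    and "\<Lambda> 0 > 1"
    and "\<And>k. 1 \<le> k \<Longrightarrow> k < m \<Longrightarrow> \<Lambda> k \<ge> 0"
    and "\<And>k. k < m \<Longrightarrow> f k holomorphic_on ball 0 1"
    and "\<And>z. z \<in> ball 0 1 \<Longrightarrow> F z = (\<Sum>k<m. cnj z ^ k * f k z)"
    and "\<And>k. k < m \<Longrightarrow> f k 0 = 0"
    and "wirtinger_dz F 0 = 1"
    and "\<And>z. z \<in> ball 0 1 \<Longrightarrow> cmod (deriv (f 0) z) < \<Lambda> 0"
    and "\<And>k z. 1 \<le> k \<Longrightarrow> k < m \<Longrightarrow> z \<in> ball 0 1 \<Longrightarrow> cmod (deriv (f k) z) \<le> \<Lambda> k"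
  shows "(\<exists>!r3. r3 \<in> {0<..<1} \<and> lower_const m \<Lambda> r3 = 0) \<and>
    (\<forall>r3 \<rho>3. r3 \<in> {0<..<1} \<and> lower_const m \<Lambda> r3 = 0 \<and> \<rho>3 \<in> {0<..<r3} \<longrightarrow>
       bi_lipschitz_on (cball 0 \<rho>3) F \<and>
       lower_const m \<Lambda> \<rho>3 > 0 \<and>
       bi_lipschitz_with (lower_const m \<Lambda> \<rho>3) (upper_const m \<Lambda> \<rho>3) (cball 0 \<rho>3) F)"
proof (intro conjI allI impI)
  show "\<exists>!r3. r3 \<in> {0<..<1} \<and> lower_const m \<Lambda> r3 = 0"
    by (rule ex1_root_lower_const) (use assms(2,3) in auto)
next
  fix r3 \<rho>3
  assume r: "r3 \<in> {0<..<1} \<and> lower_const m \<Lambda> r3 = 0 \<and> \<rho>3 \<in> {0<..<r3}"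
  \<comment> \<open>The left side is 0 at the root, so every smaller radius has a positive lower
    constant.\<close>
  have "lower_const m \<Lambda> r3 < lower_const m \<Lambda> \<rho>3"
    by (rule lower_const_strict_antimono) (use assms(2,3) r in auto)
  with r show pos: "lower_const m \<Lambda> \<rho>3 > 0" by simp
  show lip: "bi_lipschitz_with (lower_const m \<Lambda> \<rho>3) (upper_const m \<Lambda> \<rho>3) (cball 0 \<rho>3) F"
    by (rule bi_lipschitz_with_polyanalytic[where f = f]) (use assms r pos in auto)
  then show "bi_lipschitz_on (cball 0 \<rho>3) F"
    unfolding bi_lipschitz_on_def by blast
qed

end
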